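(* Let $\mathcal{A}$ and $\mathcal{B}$ be abelian categories and let $F:\mathcal{A}\to\mathcal{B}$ be an equivalence of categories, with right adjoint $G:\mathcal{B}\to\mathcal{A}$ and counit $\varepsilon:FG\to 1_{\mathcal{B}}$. Then the induced map $$\varphi:Pr(\mathcal{A})\to Pr(\mathcal{B}),\qquad \varphi(\tau)=\mathrm{Im}\big(FTG\xrightarrow{F\tau G}FG\xrightarrow{\varepsilon}1_{\mathcal{B}}\big)\quad\text{for }\tau:T\hookrightarrow 1_{\mathcal{A}},$$ is an isomorphism of partially ordered collections.
   Context: A preradical of an abelian category $\mathcal{A}$ is a subobject of the identity functor $1_{\mathcal{A}}$ in the (possibly extended) abelian category $\mathrm{Fun}(\mathcal{A},\mathcal{A})$ of endofunctors, i.e. the equivalence class of a monomorphic natural transformation $\tau:T\hookrightarrow 1_{\mathcal{A}}$ (each $\tau_A:T(A)\to A$ is a monomorphism), two such being equivalent if each factors through the other. $Pr(\mathcal{A})$ is the collection (not necessarily a set) of preradicals, partially ordered by: $\tau\leq\sigma$ iff $\tau$ factors through $\sigma$. $F\tau G$ has components $(F\tau G)_B=F(\tau_{G(B)})$, and $\mathrm{Im}$ is regarded as a subobject in $\mathrm{Fun}(\mathcal{B},\mathcal{B})$ (computed objectwise). *)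

theory Defs
  imports "HOL-Algebra.Group"
begin

section \<open>Categories\<close>

text \<open>Objects and arrows live in carrier sets inside arbitrary types, so nothing is assumed about
  the size of a category. The operations are unconstrained outside the carriers.\<close>

record ('o, 'm) cat =
  Obj :: "'o set"
  Arr :: "'m set"
  Dom :: "'m \<Rightarrow> 'o"
  Cod :: "'m \<Rightarrow> 'o"
  Ident :: "'o \<Rightarrow> 'm"
  Comp :: "'m \<Rightarrow> 'm \<Rightarrow> 'm"  (infixr "\<cdot>\<index>" 70)

definition Hom :: "('o, 'm) cat \<Rightarrow> 'o \<Rightarrow> 'o \<Rightarrow> 'm set" where
  "Hom C X Y = {f \<in> Arr C. Dom C f = X \<and> Cod C f = Y}"

locale category =
  fixes C :: "('o, 'm) cat" (structure)
  assumes Dom_in_Obj: "f \<in> Arr C \<Longrightarrow> Dom C f \<in> Obj C"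
    and Cod_in_Obj: "f \<in> Arr C \<Longrightarrow> Cod C f \<in> Obj C"
    and Ident_in_Hom: "X \<in> Obj C \<Longrightarrow> Ident C X \<in> Hom C X X"
    and Comp_in_Hom: "\<lbrakk>f \<in> Hom C X Y; g \<in> Hom C Y Z\<rbrakk> \<Longrightarrow> g \<cdot> f \<in> Hom C X Z"
    and Comp_Ident_left: "f \<in> Hom C X Y \<Longrightarrow> Ident C Y \<cdot> f = f"
    and Comp_Ident_right: "f \<in> Hom C X Y \<Longrightarrow> f \<cdot> Ident C X = f"
    and Comp_assoc: "\<lbrakk>f \<in> Hom C W X; g \<in> Hom C X Y; h \<in> Hom C Y Z\<rbrakk>
      \<Longrightarrow> (h \<cdot> g) \<cdot> f = h \<cdot> (g \<cdot> f)"

definition is_mono :: "('o, 'm) cat \<Rightarrow> 'm \<Rightarrow> bool" where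
  "is_mono C f \<longleftrightarrow> f \<in> Arr C \<and>
     (\<forall>W. \<forall>g \<in> Hom C W (Dom C f). \<forall>h \<in> Hom C W (Dom C f).
        f \<cdot>\<^bsub>C\<^esub> g = f \<cdot>\<^bsub>C\<^esub> h \<longrightarrow> g = h)"

definition is_epi :: "('o, 'm) cat \<Rightarrow> 'm \<Rightarrow> bool" where
  "is_epi C f \<longleftrightarrow> f \<in> Arr C \<and>
     (\<forall>Z. \<forall>g \<in> Hom C (Cod C f) Z. \<forall>h \<in> Hom C (Cod C f) Z.
        g \<cdot>\<^bsub>C\<^esub> f = h \<cdot>\<^bsub>C\<^esub> f \<longrightarrow> g = h)"

definition is_iso :: "('o, 'm) cat \<Rightarrow> 'm \<Rightarrow> bool" where
  "is_iso C f \<longleftrightarrow> f \<in> Arr C \<and>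
     (\<exists>g \<in> Hom C (Cod C f) (Dom C f).
        g \<cdot>\<^bsub>C\<^esub> f = Ident C (Dom C f) \<and> f \<cdot>\<^bsub>C\<^esub> g = Ident C (Cod C f))"

section \<open>Abelian categories\<close>

definition zero_object :: "('o, 'm) cat \<Rightarrow> 'o \<Rightarrow> bool" where
  "zero_object C Z \<longleftrightarrow> Z \<in> Obj C \<and>
     (\<forall>X \<in> Obj C. (\<exists>!f. f \<in> Hom C X Z) \<and> (\<exists>!f. f \<in> Hom C Z X))"

definition zero_arrow :: "('o, 'm) cat \<Rightarrow> 'm \<Rightarrow> bool" where
  "zero_arrow C f \<longleftrightarrow> f \<in> Arr C \<and>
     (\<exists>Z g h. zero_object C Z \<and> g \<in> Hom C (Dom C f) Z \<and> h \<in> Hom C Z (Cod C f) \<and>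
        f = h \<cdot>\<^bsub>C\<^esub> g)"

definition is_kernel :: "('o, 'm) cat \<Rightarrow> 'm \<Rightarrow> 'm \<Rightarrow> bool" where
  "is_kernel C f k \<longleftrightarrow> f \<in> Arr C \<and> k \<in> Arr C \<and> Cod C k = Dom C f \<and>
     zero_arrow C (f \<cdot>\<^bsub>C\<^esub> k) \<and>
     (\<forall>W. \<forall>h \<in> Hom C W (Dom C f). zero_arrow C (f \<cdot>\<^bsub>C\<^esub> h) \<longrightarrow>
        (\<exists>!u. u \<in> Hom C W (Dom C k) \<and> k \<cdot>\<^bsub>C\<^esub> u = h))"

definition is_cokernel :: "('o, 'm) cat \<Rightarrow> 'm \<Rightarrow> 'm \<Rightarrow> bool" where
  "is_cokernel C f c \<longleftrightarrow> f \<in> Arr C \<and> c \<in> Arr C \<and> Dom C c = Cod C f \<and>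
     zero_arrow C (c \<cdot>\<^bsub>C\<^esub> f) \<and>
     (\<forall>Z. \<forall>h \<in> Hom C (Cod C f) Z. zero_arrow C (h \<cdot>\<^bsub>C\<^esub> f) \<longrightarrow>
        (\<exists>!u. u \<in> Hom C (Cod C c) Z \<and> u \<cdot>\<^bsub>C\<^esub> c = h))"

text \<open>As usual in an abelian category, the image is the kernel of the cokernel.\<close>

definition is_image :: "('o, 'm) cat \<Rightarrow> 'm \<Rightarrow> 'm \<Rightarrow> bool" where
  "is_image C f m \<longleftrightarrow> (\<exists>c. is_cokernel C f c \<and> is_kernel C c m)"

text \<open>Hom-sets are disjoint, so a single operation \<open>add\<close> on arrows carries the group structures of
  all hom-sets.\<close>

locale preadditive_category = category C
  for C :: "('o, 'm) cat" (structure) +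
  fixes add :: "'m \<Rightarrow> 'm \<Rightarrow> 'm"
  assumes Hom_comm_group: "\<lbrakk>X \<in> Obj C; Y \<in> Obj C\<rbrakk>
      \<Longrightarrow> \<exists>z. comm_group \<lparr>carrier = Hom C X Y, monoid.mult = add, one = z\<rparr>"
    and Comp_add_left: "\<lbrakk>f \<in> Hom C X Y; g \<in> Hom C Y Z; g' \<in> Hom C Y Z\<rbrakk>
      \<Longrightarrow> add g g' \<cdot> f = add (g \<cdot> f) (g' \<cdot> f)"
    and Comp_add_right: "\<lbrakk>f \<in> Hom C X Y; f' \<in> Hom C X Y; g \<in> Hom C Y Z\<rbrakk>
      \<Longrightarrow> g \<cdot> add f f' = add (g \<cdot> f) (g \<cdot> f')"

definition is_biproduct ::
    "('o, 'm) cat \<Rightarrow> ('m \<Rightarrow> 'm \<Rightarrow> 'm) \<Rightarrow> 'o \<Rightarrow> 'o \<Rightarrow> 'o \<Rightarrow> 'm \<Rightarrow> 'm \<Rightarrow> 'm \<Rightarrow> 'm \<Rightarrow> bool" where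
  "is_biproduct C add X Y P i j p q \<longleftrightarrow> P \<in> Obj C \<and>
     i \<in> Hom C X P \<and> j \<in> Hom C Y P \<and> p \<in> Hom C P X \<and> q \<in> Hom C P Y \<and>
     p \<cdot>\<^bsub>C\<^esub> i = Ident C X \<and> q \<cdot>\<^bsub>C\<^esub> j = Ident C Y \<and>
     add (i \<cdot>\<^bsub>C\<^esub> p) (j \<cdot>\<^bsub>C\<^esub> q) = Ident C P"

locale additive_category = preadditive_category +
  assumes ex_zero_object: "\<exists>Z. zero_object C Z"
    and ex_biproduct: "\<lbrakk>X \<in> Obj C; Y \<in> Obj C\<rbrakk> \<Longrightarrow> \<exists>P i j p q. is_biproduct C add X Y P i j p q"

text \<open>Being abelian is a property of the bare category: the addition, if there is one, is
  determined by it.\<close>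

definition abelian_category :: "('o, 'm) cat \<Rightarrow> bool" where
  "abelian_category C \<longleftrightarrow>
     (\<exists>add. additive_category C add) \<and>
     (\<forall>f \<in> Arr C. (\<exists>k. is_kernel C f k) \<and> (\<exists>c. is_cokernel C f c)) \<and>
     (\<forall>m. is_mono C m \<longrightarrow> (\<exists>f. is_kernel C f m)) \<and>
     (\<forall>e. is_epi C e \<longrightarrow> (\<exists>f. is_cokernel C f e))"

section \<open>Functors, natural transformations, adjunctions, equivalences\<close>

record ('o, 'm, 'p, 'n) func =
  omap :: "'o \<Rightarrow> 'p"
  amap :: "'m \<Rightarrow> 'n"

definition is_functor ::
    "('o, 'm) cat \<Rightarrow> ('p, 'n) cat \<Rightarrow> ('o, 'm, 'p, 'n) func \<Rightarrow> bool" where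
  "is_functor A B F \<longleftrightarrow>
     (\<forall>X \<in> Obj A. omap F X \<in> Obj B) \<and>
     (\<forall>X Y. \<forall>f \<in> Hom A X Y. amap F f \<in> Hom B (omap F X) (omap F Y)) \<and>
     (\<forall>X \<in> Obj A. amap F (Ident A X) = Ident B (omap F X)) \<and>
     (\<forall>X Y Z. \<forall>f \<in> Hom A X Y. \<forall>g \<in> Hom A Y Z.
        amap F (g \<cdot>\<^bsub>A\<^esub> f) = amap F g \<cdot>\<^bsub>B\<^esub> amap F f)"

definition id_func :: "('o, 'm, 'o, 'm) func" where
  "id_func = \<lparr>omap = (\<lambda>X. X), amap = (\<lambda>f. f)\<rparr>"

definition comp_func ::
    "('p, 'n, 'q, 'k) func \<Rightarrow> ('o, 'm, 'p, 'n) func \<Rightarrow> ('o, 'm, 'q, 'k) func"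
    (infixr "\<circ>\<^sub>F" 75) where
  "G \<circ>\<^sub>F F = \<lparr>omap = (\<lambda>X. omap G (omap F X)), amap = (\<lambda>f. amap G (amap F f))\<rparr>"

definition nat_trans :: "('o, 'm) cat \<Rightarrow> ('p, 'n) cat \<Rightarrow>
    ('o, 'm, 'p, 'n) func \<Rightarrow> ('o, 'm, 'p, 'n) func \<Rightarrow> ('o \<Rightarrow> 'n) \<Rightarrow> bool" where
  "nat_trans A B S T \<eta> \<longleftrightarrow> is_functor A B S \<and> is_functor A B T \<and>
     (\<forall>X \<in> Obj A. \<eta> X \<in> Hom B (omap S X) (omap T X)) \<and>
     (\<forall>X Y. \<forall>f \<in> Hom A X Y. \<eta> Y \<cdot>\<^bsub>B\<^esub> amap S f = amap T f \<cdot>\<^bsub>B\<^esub> \<eta> X)"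

definition nat_iso :: "('o, 'm) cat \<Rightarrow> ('p, 'n) cat \<Rightarrow>
    ('o, 'm, 'p, 'n) func \<Rightarrow> ('o, 'm, 'p, 'n) func \<Rightarrow> ('o \<Rightarrow> 'n) \<Rightarrow> bool" where
  "nat_iso A B S T \<eta> \<longleftrightarrow> nat_trans A B S T \<eta> \<and> (\<forall>X \<in> Obj A. is_iso B (\<eta> X))"

definition is_equivalence ::
    "('o, 'm) cat \<Rightarrow> ('p, 'n) cat \<Rightarrow> ('o, 'm, 'p, 'n) func \<Rightarrow> bool" where
  "is_equivalence A B F \<longleftrightarrow> is_functor A B F \<and>
     (\<exists>G \<alpha> \<beta>. is_functor B A G \<and>
        nat_iso A A id_func (G \<circ>\<^sub>F F) \<alpha> \<and> nat_iso B B (F \<circ>\<^sub>F G) id_func \<beta>)"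

text \<open>\<open>G\<close> is right adjoint to \<open>F\<close>, with unit \<open>\<eta>\<close> and counit \<open>\<epsilon>\<close>.\<close>

definition is_adjunction :: "('o, 'm) cat \<Rightarrow> ('p, 'n) cat \<Rightarrow>
    ('o, 'm, 'p, 'n) func \<Rightarrow> ('p, 'n, 'o, 'm) func \<Rightarrow> ('o \<Rightarrow> 'm) \<Rightarrow> ('p \<Rightarrow> 'n) \<Rightarrow> bool" where
  "is_adjunction A B F G \<eta> \<epsilon> \<longleftrightarrow> is_functor A B F \<and> is_functor B A G \<and>
     nat_trans A A id_func (G \<circ>\<^sub>F F) \<eta> \<and> nat_trans B B (F \<circ>\<^sub>F G) id_func \<epsilon> \<and>
     (\<forall>X \<in> Obj A. \<epsilon> (omap F X) \<cdot>\<^bsub>B\<^esub> amap F (\<eta> X) = Ident B (omap F X)) \<and>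
     (\<forall>Y \<in> Obj B. amap G (\<epsilon> Y) \<cdot>\<^bsub>A\<^esub> \<eta> (omap G Y) = Ident A (omap G Y))"

section \<open>Preradicals\<close>

text \<open>A monomorphic natural transformation \<open>\<tau> : T \<hookrightarrow> 1\<close> is represented by the pair \<open>(T, \<tau>)\<close>.\<close>

type_synonym ('o, 'm) over_id = "('o, 'm, 'o, 'm) func \<times> ('o \<Rightarrow> 'm)"

definition mono_trans :: "('o, 'm) cat \<Rightarrow> ('o, 'm) over_id set" where
  "mono_trans A =
     {(T, \<tau>). nat_trans A A T id_func \<tau> \<and> (\<forall>X \<in> Obj A. is_mono A (\<tau> X))}"

definition factors :: "('o, 'm) cat \<Rightarrow> ('o, 'm) over_id \<Rightarrow> ('o, 'm) over_id \<Rightarrow> bool" where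
  "factors A = (\<lambda>(T, \<tau>) (S, \<sigma>).
     \<exists>\<theta>. nat_trans A A T S \<theta> \<and> (\<forall>X \<in> Obj A. \<tau> X = \<sigma> X \<cdot>\<^bsub>A\<^esub> \<theta> X))"

definition same_subobject :: "('o, 'm) cat \<Rightarrow> (('o, 'm) over_id \<times> ('o, 'm) over_id) set" where
  "same_subobject A =
     {(p, q). p \<in> mono_trans A \<and> q \<in> mono_trans A \<and> factors A p q \<and> factors A q p}"

definition Pr :: "('o, 'm) cat \<Rightarrow> ('o, 'm) over_id set set" where
  "Pr A = mono_trans A // same_subobject A"

definition preradical :: "('o, 'm) cat \<Rightarrow> ('o, 'm) over_id \<Rightarrow> ('o, 'm) over_id set" where
  "preradical A p = same_subobject A `` {p}"

definition Pr_le :: "('o, 'm) cat \<Rightarrow> ('o, 'm) over_id set \<Rightarrow> ('o, 'm) over_id set \<Rightarrow> bool" where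
  "Pr_le A P Q \<longleftrightarrow> (\<exists>p \<in> P. \<exists>q \<in> Q. factors A p q)"

text \<open>The image of a natural transformation into the identity functor with components \<open>\<alpha> Y\<close>,
  computed objectwise. All choices of an image functor are collected, which gives a whole
  equivalence class of monomorphic natural transformations rather than one representative.\<close>

definition Im_trans :: "('o, 'm) cat \<Rightarrow> ('o \<Rightarrow> 'm) \<Rightarrow> ('o, 'm) over_id set" where
  "Im_trans B \<alpha> = {(I, \<iota>) \<in> mono_trans B. \<forall>Y \<in> Obj B. is_image B (\<alpha> Y) (\<iota> Y)}"

text \<open>The components of \<open>FTG \<rightarrow> FG \<rightarrow> 1\<close>, the composite of \<open>F\<tau>G\<close> and \<open>\<epsilon>\<close>.\<close>

definition transported :: "('p, 'n) cat \<Rightarrow> ('o, 'm, 'p, 'n) func \<Rightarrow> ('p, 'n, 'o, 'm) func \<Rightarrow>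
    ('p \<Rightarrow> 'n) \<Rightarrow> ('o \<Rightarrow> 'm) \<Rightarrow> ('p \<Rightarrow> 'n)" where
  "transported B F G \<epsilon> \<tau> = (\<lambda>Y. \<epsilon> Y \<cdot>\<^bsub>B\<^esub> amap F (\<tau> (omap G Y)))"

text \<open>The map induced on equivalence classes. The union is over representatives of one class, whose
  images all coincide.\<close>

definition induced_map :: "('p, 'n) cat \<Rightarrow> ('o, 'm, 'p, 'n) func \<Rightarrow> ('p, 'n, 'o, 'm) func \<Rightarrow>
    ('p \<Rightarrow> 'n) \<Rightarrow> ('o, 'm) over_id set \<Rightarrow> ('p, 'n) over_id set" where
  "induced_map B F G \<epsilon> P = (\<Union>(T, \<tau>) \<in> P. Im_trans B (transported B F G \<epsilon> \<tau>))"

end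

theory Submission
  imports Defs
begin

text \<open>An arrow that is already monic is its own image in an abelian category, so
  \<open>\<phi>\<close> sends the class of \<open>\<tau>\<close> to the class of \<open>\<epsilon> \<cdot> F\<tau>G\<close>. For an equivalence both \<open>\<epsilon>\<close> and \<open>\<eta>\<close> are
  natural isomorphisms; exchanging the roles of \<open>\<epsilon>\<close> and \<open>\<eta>\<^sup>-\<^sup>1\<close> gives a monotone map
  \<open>\<sigma> \<mapsto> \<eta>\<^sup>-\<^sup>1 \<cdot> G\<sigma>F\<close> in the other direction. The two maps are inverse to each other on classes
  because naturality of \<open>\<sigma>\<close> gives \<open>a \<cdot> \<sigma>\<^sub>Z = \<sigma>\<^sub>W \<cdot> S(a)\<close> for every isomorphism \<open>a : Z \<rightarrow> W\<close>.\<close>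

section \<open>Arrows in a category\<close>

context category
begin

lemma Hom_iff: "f \<in> Hom C X Y \<longleftrightarrow> f \<in> Arr C \<and> Dom C f = X \<and> Cod C f = Y"
  by (simp add: Hom_def)

lemma Hom_Obj: "f \<in> Hom C X Y \<Longrightarrow> X \<in> Obj C \<and> Y \<in> Obj C"
  using Dom_in_Obj Cod_in_Obj by (auto simp: Hom_def)

lemma Comp_Arr:
  assumes "f \<in> Arr C" "g \<in> Arr C" "Cod C f = Dom C g"
  shows "g \<cdot> f \<in> Arr C" "Dom C (g \<cdot> f) = Dom C f" "Cod C (g \<cdot> f) = Cod C g"
  using Comp_in_Hom[of f "Dom C f" "Cod C f" g "Cod C g"] assms by (auto simp: Hom_def)

lemma Comp_assoc_Arr:
  assumes "f \<in> Arr C" "g \<in> Arr C" "h \<in> Arr C" "Cod C f = Dom C g" "Cod C g = Dom C h"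
  shows "(h \<cdot> g) \<cdot> f = h \<cdot> (g \<cdot> f)"
  using Comp_assoc[of f "Dom C f" "Cod C f" g "Cod C g" h "Cod C h"] assms by (auto simp: Hom_def)

text \<open>Rewriting with these rules moves all brackets to the right and reduces membership in a
  hom-set to equations between domains and codomains, which are also the side conditions of
  associativity.\<close>

lemmas arr_simps = Comp_Arr Comp_assoc_Arr Hom_iff

section \<open>Monomorphisms and isomorphisms\<close>

lemma mono_cancel:
  assumes "is_mono C m" "m \<cdot> f = m \<cdot> g" "f \<in> Hom C W (Dom C m)" "g \<in> Hom C W (Dom C m)"
  shows "f = g"
  using assms unfolding is_mono_def by blast

lemma is_monoI:
  assumes "m \<in> Arr C"
    and "\<And>W f g. \<lbrakk>f \<in> Hom C W (Dom C m); g \<in> Hom C W (Dom C m); m \<cdot> f = m \<cdot> g\<rbrakk> \<Longrightarrow> f = g"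
  shows "is_mono C m"
  using assms unfolding is_mono_def by blast

lemma iso_inverse:
  assumes "is_iso C a" "a \<in> Hom C X Y"
  obtains b where "b \<in> Hom C Y X" "b \<cdot> a = Ident C X" "a \<cdot> b = Ident C Y"
  using assms unfolding is_iso_def by (auto simp: Hom_def)

lemma is_isoI:
  assumes "a \<in> Hom C X Y" "b \<in> Hom C Y X" "b \<cdot> a = Ident C X" "a \<cdot> b = Ident C Y"
  shows "is_iso C a"
  using assms unfolding is_iso_def by (auto simp: Hom_def)

lemma iso_Comp:
  assumes "is_iso C a" "a \<in> Hom C X Y" "is_iso C b" "b \<in> Hom C Y Z"
  shows "is_iso C (b \<cdot> a)"
proof -
  obtain a' where a': "a' \<in> Hom C Y X" "a' \<cdot> a = Ident C X" "a \<cdot> a' = Ident C Y"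
    using iso_inverse assms by blast
  obtain b' where b': "b' \<in> Hom C Z Y" "b' \<cdot> b = Ident C Y" "b \<cdot> b' = Ident C Z"
    using iso_inverse assms by blast
  have "(a' \<cdot> b') \<cdot> (b \<cdot> a) = a' \<cdot> ((b' \<cdot> b) \<cdot> a)"
    using assms a'(1) b'(1) by (simp add: arr_simps)
  also have "\<dots> = Ident C X"
    using a' b' assms(2) by (simp add: Comp_Ident_left)
  finally have 1: "(a' \<cdot> b') \<cdot> (b \<cdot> a) = Ident C X" .
  have "(b \<cdot> a) \<cdot> (a' \<cdot> b') = b \<cdot> ((a \<cdot> a') \<cdot> b')"
    using assms a'(1) b'(1) by (simp add: arr_simps)
  also have "\<dots> = Ident C Z"
    using a' b' by (simp add: Comp_Ident_left)
  finally have 2: "(b \<cdot> a) \<cdot> (a' \<cdot> b') = Ident C Z" .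
  show ?thesis
    using is_isoI[OF Comp_in_Hom[OF assms(2,4)] Comp_in_Hom[OF b'(1) a'(1)] 1 2] .
qed

lemma iso_is_mono:
  assumes "is_iso C a"
  shows "is_mono C a"
proof (rule is_monoI)
  show "a \<in> Arr C" using assms by (simp add: is_iso_def)
  fix W f g
  assume fg: "f \<in> Hom C W (Dom C a)" "g \<in> Hom C W (Dom C a)" "a \<cdot> f = a \<cdot> g"
  obtain b where b: "b \<in> Hom C (Cod C a) (Dom C a)" "b \<cdot> a = Ident C (Dom C a)"
    using assms unfolding is_iso_def by blast
  have "(b \<cdot> a) \<cdot> f = (b \<cdot> a) \<cdot> g"
    using fg b(1) \<open>a \<in> Arr C\<close> by (simp add: arr_simps)
  then show "f = g"
    using fg b by (simp add: Comp_Ident_left)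
qed

lemma mono_Comp:
  assumes "is_mono C m" "is_mono C n" "Cod C m = Dom C n"
  shows "is_mono C (n \<cdot> m)"
proof (rule is_monoI)
  have Arr: "m \<in> Arr C" "n \<in> Arr C"
    using assms by (simp_all add: is_mono_def)
  then show "n \<cdot> m \<in> Arr C"
    using assms by (simp add: arr_simps)
  fix W f g
  assume "f \<in> Hom C W (Dom C (n \<cdot> m))" "g \<in> Hom C W (Dom C (n \<cdot> m))"
    and eq: "(n \<cdot> m) \<cdot> f = (n \<cdot> m) \<cdot> g"
  then have fg: "f \<in> Hom C W (Dom C m)" "g \<in> Hom C W (Dom C m)"
    using Arr assms(3) by (simp_all add: arr_simps)
  have "n \<cdot> (m \<cdot> f) = n \<cdot> (m \<cdot> g)"
    using eq fg Arr assms(3) by (simp add: arr_simps)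
  moreover have "m \<cdot> f \<in> Hom C W (Dom C n)" "m \<cdot> g \<in> Hom C W (Dom C n)"
    using fg Arr assms(3) by (simp_all add: arr_simps)
  ultimately have "m \<cdot> f = m \<cdot> g"
    using mono_cancel assms(2) by blast
  then show "f = g"
    using mono_cancel assms(1) fg by blast
qed

lemma mono_right_factor:
  assumes "is_mono C (n \<cdot> m)" "m \<in> Hom C X Y" "n \<in> Hom C Y Z"
  shows "is_mono C m"
proof (rule is_monoI)
  show "m \<in> Arr C" using assms by (simp add: Hom_iff)
  fix W f g
  assume fg: "f \<in> Hom C W (Dom C m)" "g \<in> Hom C W (Dom C m)" "m \<cdot> f = m \<cdot> g"
  have "(n \<cdot> m) \<cdot> f = (n \<cdot> m) \<cdot> g"
    using fg assms(2,3) by (simp add: arr_simps)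
  then show "f = g"
    by (rule mono_cancel[OF assms(1)]) (use fg(1,2) assms(2,3) in \<open>simp_all add: arr_simps\<close>)
qed

section \<open>Zero arrows, kernels and images\<close>

lemma zero_arrowI:
  assumes "zero_object C Z" "g \<in> Hom C X Z" "h \<in> Hom C Z Y"
  shows "zero_arrow C (h \<cdot> g)"
proof -
  have "h \<cdot> g \<in> Arr C" "Dom C (h \<cdot> g) = X" "Cod C (h \<cdot> g) = Y"
    using assms(2,3) by (simp_all add: arr_simps)
  then show ?thesis
    unfolding zero_arrow_def using assms by (intro conjI exI[of _ Z] exI[of _ g] exI[of _ h]) simp_all
qed

text \<open>The factorization through a zero object survives: composing at one end only lengthens
  the leg at that end.\<close>

lemma zero_arrow_Comp:
  assumes "zero_arrow C f"
  shows "\<lbrakk>a \<in> Arr C; Dom C a = Cod C f\<rbrakk> \<Longrightarrow> zero_arrow C (a \<cdot> f)"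
    and "\<lbrakk>b \<in> Arr C; Cod C b = Dom C f\<rbrakk> \<Longrightarrow> zero_arrow C (f \<cdot> b)"
proof -
  from assms have "\<exists>Z g h. zero_object C Z \<and> g \<in> Hom C (Dom C f) Z \<and> h \<in> Hom C Z (Cod C f) \<and> f = h \<cdot> g"
    unfolding zero_arrow_def by (rule conjunct2)
  then obtain Z g h where Z: "zero_object C Z" and g: "g \<in> Hom C (Dom C f) Z"
    and h: "h \<in> Hom C Z (Cod C f)" and f: "f = h \<cdot> g"
    by (elim exE conjE) (rule that)
  show "zero_arrow C (a \<cdot> f)" if a: "a \<in> Arr C" "Dom C a = Cod C f"
  proof -
    have a': "a \<in> Hom C (Cod C f) (Cod C a)"
      using a by (simp add: Hom_iff)
    have "a \<cdot> f = (a \<cdot> h) \<cdot> g"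
      using Comp_assoc[OF g h a'] f by simp
    then show ?thesis
      using zero_arrowI[OF Z g Comp_in_Hom[OF h a']] by simp
  qed
  show "zero_arrow C (f \<cdot> b)" if b: "b \<in> Arr C" "Cod C b = Dom C f"
  proof -
    have b': "b \<in> Hom C (Dom C b) (Dom C f)"
      using b by (simp add: Hom_iff)
    have "f \<cdot> b = h \<cdot> (g \<cdot> b)"
      using Comp_assoc[OF b' g h] f by simp
    then show ?thesis
      using zero_arrowI[OF Z Comp_in_Hom[OF b' g] h] by simp
  qed
qed

lemma kernel_factor:
  assumes "is_kernel C f k" "h \<in> Hom C W (Dom C f)" "zero_arrow C (f \<cdot> h)"
  obtains u where "u \<in> Hom C W (Dom C k)" "k \<cdot> u = h"
  using assms unfolding is_kernel_def by meson

lemma cokernel_factor: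
  assumes "is_cokernel C f c" "h \<in> Hom C (Cod C f) Z" "zero_arrow C (h \<cdot> f)"
  obtains u where "u \<in> Hom C (Cod C c) Z" "u \<cdot> c = h"
  using assms unfolding is_cokernel_def by meson

text \<open>A monomorphism is a kernel of some \<open>g\<close>, and therefore also a kernel of each
  of its cokernels. Kernels of one arrow are unique up to isomorphism, so the images of
  \<open>f\<close> are the monomorphisms that represent the same subobject as
  \<open>f\<close>.\<close>

lemma is_image_mono_iff:
  assumes "abelian_category C" "f \<in> Hom C X Y" "is_mono C f" "m \<in> Hom C I Y" "is_mono C m"
  shows "is_image C f m \<longleftrightarrow> (\<exists>u \<in> Hom C X I. f = m \<cdot> u) \<and> (\<exists>v \<in> Hom C I X. m = f \<cdot> v)"
proof -
  obtain g where g: "is_kernel C g f"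
    using assms unfolding abelian_category_def by blast
  \<comment> \<open>This is the universal property of \<open>f\<close> as a kernel of
    \<open>c\<close>. Since \<open>g\<close> kills \<open>f\<close>, it factors as \<open>w\<close>
    after \<open>c\<close>; so \<open>g\<close> kills whatever \<open>c\<close> kills, and such an
    arrow factors through \<open>f\<close>, the kernel of \<open>g\<close>.\<close>
  have through_f: "\<exists>v \<in> Hom C W X. h = f \<cdot> v"
    if c: "is_cokernel C f c" and h: "h \<in> Hom C W Y" and z: "zero_arrow C (c \<cdot> h)" for c h W
  proof -
    have c': "c \<in> Arr C" "Dom C c = Y"
      using c assms(2) by (auto simp: is_cokernel_def Hom_def)
    have g': "g \<in> Hom C Y (Cod C g)" "zero_arrow C (g \<cdot> f)"
      using g assms(2) by (auto simp: is_kernel_def Hom_def)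
    have "g \<in> Hom C (Cod C f) (Cod C g)"
      using g'(1) assms(2) by (simp add: Hom_iff)
    then obtain w where w: "w \<in> Hom C (Cod C c) (Cod C g)" "w \<cdot> c = g"
      using cokernel_factor[OF c _ g'(2)] by blast
    have "c \<in> Hom C Y (Cod C c)"
      using c' by (simp add: Hom_iff)
    from Comp_assoc[OF h this w(1)] w(2) have "g \<cdot> h = w \<cdot> (c \<cdot> h)"
      by simp
    moreover have "zero_arrow C (w \<cdot> (c \<cdot> h))"
      by (rule zero_arrow_Comp(1)[OF z]) (use w(1) h c' in \<open>auto simp: arr_simps\<close>)
    ultimately have "zero_arrow C (g \<cdot> h)" "h \<in> Hom C W (Dom C g)"
      using h g'(1) by (auto simp: Hom_def)
    then obtain v where "v \<in> Hom C W (Dom C f)" "f \<cdot> v = h"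
      using kernel_factor[OF g] by blast
    then show ?thesis
      using assms(2) by (auto simp: Hom_iff)
  qed
  show ?thesis
  proof
    assume "is_image C f m"
    then obtain c where c: "is_cokernel C f c" "is_kernel C c m"
      unfolding is_image_def by blast
    have "zero_arrow C (c \<cdot> f)" "f \<in> Hom C X (Dom C c)"
      using c(1) assms(2) by (auto simp: is_cokernel_def Hom_def)
    then obtain u where u: "u \<in> Hom C X (Dom C m)" "m \<cdot> u = f"
      using kernel_factor[OF c(2)] by blast
    have "\<exists>u \<in> Hom C X I. f = m \<cdot> u"
      using u assms(4) by (intro bexI[of _ u]) (simp_all add: Hom_iff)
    moreover have "\<exists>v \<in> Hom C I X. m = f \<cdot> v"
      using through_f[OF c(1) assms(4)] c(2) by (simp add: is_kernel_def)
    ultimately show "(\<exists>u \<in> Hom C X I. f = m \<cdot> u) \<and> (\<exists>v \<in> Hom C I X. m = f \<cdot> v)" ..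
  next
    assume "(\<exists>u \<in> Hom C X I. f = m \<cdot> u) \<and> (\<exists>v \<in> Hom C I X. m = f \<cdot> v)"
    then obtain u v where u: "u \<in> Hom C X I" "f = m \<cdot> u" and v: "v \<in> Hom C I X" "m = f \<cdot> v"
      by blast
    obtain c where c: "is_cokernel C f c"
      using assms(1,2) unfolding abelian_category_def Hom_def by blast
    have c': "c \<in> Arr C" "Dom C c = Y" "zero_arrow C (c \<cdot> f)"
      using c assms(2) by (auto simp: is_cokernel_def Hom_def)
    have "c \<in> Hom C Y (Cod C c)"
      using c' by (simp add: Hom_iff)
    from Comp_assoc[OF v(1) assms(2) this] v(2) have "c \<cdot> m = (c \<cdot> f) \<cdot> v"
      by simp
    moreover have "zero_arrow C ((c \<cdot> f) \<cdot> v)"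
      by (rule zero_arrow_Comp(2)[OF c'(3)]) (use v(1) assms(2) c' in \<open>auto simp: arr_simps\<close>)
    ultimately have zero: "zero_arrow C (c \<cdot> m)"
      by simp
    have m: "m \<in> Arr C" "Cod C m = Y"
      using assms(4) by (simp_all add: Hom_iff)
    \<comment> \<open>The factorization through \<open>f\<close> followed by \<open>u\<close> gives
      existence, monicity of \<open>m\<close> gives uniqueness. The other arrow \<open>v\<close> has
      served to show that \<open>c\<close> kills \<open>m\<close>.\<close>
    have "\<exists>!x. x \<in> Hom C W (Dom C m) \<and> m \<cdot> x = h"
      if h: "h \<in> Hom C W (Dom C c)" "zero_arrow C (c \<cdot> h)" for W h
    proof (rule ex_ex1I)
      obtain x where x: "x \<in> Hom C W X" "h = f \<cdot> x"
        using through_f[OF c] h c' by blast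
      have "h = m \<cdot> (u \<cdot> x)"
        using Comp_assoc[OF x(1) u(1) assms(4)] x(2) u(2) by simp
      moreover have "u \<cdot> x \<in> Hom C W (Dom C m)"
        using x(1) u(1) assms(4) by (auto simp: arr_simps)
      ultimately show "\<exists>x. x \<in> Hom C W (Dom C m) \<and> m \<cdot> x = h"
        by blast
    next
      show "x = y" if "x \<in> Hom C W (Dom C m) \<and> m \<cdot> x = h" "y \<in> Hom C W (Dom C m) \<and> m \<cdot> y = h"
        for x y
        using that mono_cancel[OF assms(5)] by blast
    qed
    then have "is_kernel C c m"
      using c' zero m unfolding is_kernel_def by simp
    with c show "is_image C f m"
      unfolding is_image_def by blast
  qed
qed

end

lemma abelian_category_category: "abelian_category C \<Longrightarrow> category C"
  unfolding abelian_category_def additive_category_def preadditive_category_def by blast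

section \<open>Functors\<close>

lemma functor_Obj: "is_functor A B F \<Longrightarrow> X \<in> Obj A \<Longrightarrow> omap F X \<in> Obj B"
  by (simp add: is_functor_def)

lemma functor_Hom: "is_functor A B F \<Longrightarrow> f \<in> Hom A X Y \<Longrightarrow> amap F f \<in> Hom B (omap F X) (omap F Y)"
  by (simp add: is_functor_def)

lemma functor_Ident: "is_functor A B F \<Longrightarrow> X \<in> Obj A \<Longrightarrow> amap F (Ident A X) = Ident B (omap F X)"
  by (simp add: is_functor_def)

lemma functor_Comp:
  "\<lbrakk>is_functor A B F; f \<in> Hom A X Y; g \<in> Hom A Y Z\<rbrakk>
    \<Longrightarrow> amap F (g \<cdot>\<^bsub>A\<^esub> f) = amap F g \<cdot>\<^bsub>B\<^esub> amap F f"
  unfolding is_functor_def by blast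

lemma functor_comp_func: "\<lbrakk>is_functor A B F; is_functor B C G\<rbrakk> \<Longrightarrow> is_functor A C (G \<circ>\<^sub>F F)"
  unfolding is_functor_def comp_func_def by simp metis

lemma functor_id_func: "is_functor A A id_func"
  by (simp add: is_functor_def id_func_def)

lemma functor_iso:
  assumes "category A" "category B" "is_functor A B F" "is_iso A a" "a \<in> Hom A X Y"
  shows "is_iso B (amap F a)"
proof -
  interpret A: category A by fact
  interpret B: category B by fact
  obtain b where b: "b \<in> Hom A Y X" "b \<cdot>\<^bsub>A\<^esub> a = Ident A X" "a \<cdot>\<^bsub>A\<^esub> b = Ident A Y"
    using A.iso_inverse assms(4,5) by blast
  have "X \<in> Obj A" "Y \<in> Obj A"
    using A.Hom_Obj assms(5) by blast+
  then have "amap F b \<cdot>\<^bsub>B\<^esub> amap F a = Ident B (omap F X)"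
    "amap F a \<cdot>\<^bsub>B\<^esub> amap F b = Ident B (omap F Y)"
    using functor_Comp[OF assms(3) assms(5) b(1)] functor_Comp[OF assms(3) b(1) assms(5)]
      functor_Ident[OF assms(3)] b(2,3) by simp_all
  then show ?thesis
    using B.is_isoI[OF functor_Hom[OF assms(3) assms(5)] functor_Hom[OF assms(3) b(1)]] by blast
qed

text \<open>The componentwise inverses are natural, because a commuting square whose two parallel
  sides are invertible still commutes after these are inverted.\<close>

lemma nat_iso_inverse:
  assumes "category A" "category B" "nat_iso A B S T \<eta>"
  obtains \<theta> where "nat_iso A B T S \<theta>"
proof -
  interpret A: category A by fact
  interpret B: category B by fact
  have S: "is_functor A B S" and T: "is_functor A B T"
    and \<eta>: "\<And>X. X \<in> Obj A \<Longrightarrow> \<eta> X \<in> Hom B (omap S X) (omap T X)"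
    and nat: "\<And>X Y f. f \<in> Hom A X Y \<Longrightarrow> \<eta> Y \<cdot>\<^bsub>B\<^esub> amap S f = amap T f \<cdot>\<^bsub>B\<^esub> \<eta> X"
    and iso: "\<And>X. X \<in> Obj A \<Longrightarrow> is_iso B (\<eta> X)"
    using assms(3) unfolding nat_iso_def nat_trans_def by blast+
  have "\<exists>b. b \<in> Hom B (omap T X) (omap S X) \<and> b \<cdot>\<^bsub>B\<^esub> \<eta> X = Ident B (omap S X)
      \<and> \<eta> X \<cdot>\<^bsub>B\<^esub> b = Ident B (omap T X)" if "X \<in> Obj A" for X
    using B.iso_inverse iso \<eta> that by metis
  then obtain \<theta> where \<theta>: "\<And>X. X \<in> Obj A \<Longrightarrow> \<theta> X \<in> Hom B (omap T X) (omap S X)"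
    and \<theta>1: "\<And>X. X \<in> Obj A \<Longrightarrow> \<theta> X \<cdot>\<^bsub>B\<^esub> \<eta> X = Ident B (omap S X)"
    and \<theta>2: "\<And>X. X \<in> Obj A \<Longrightarrow> \<eta> X \<cdot>\<^bsub>B\<^esub> \<theta> X = Ident B (omap T X)"
    by metis
  have "\<theta> Y \<cdot>\<^bsub>B\<^esub> amap T f = amap S f \<cdot>\<^bsub>B\<^esub> \<theta> X" if f: "f \<in> Hom A X Y" for f X Y
  proof -
    have X: "X \<in> Obj A" and Y: "Y \<in> Obj A"
      using A.Hom_Obj f by blast+
    note h = \<eta>[OF X] \<eta>[OF Y] \<theta>[OF X] \<theta>[OF Y] functor_Hom[OF S f] functor_Hom[OF T f]
    \<comment> \<open>The identity of \<open>omap T X\<close> is inserted as \<open>\<eta> X\<close>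
      after \<open>\<theta> X\<close>, so that the square of \<eta> at \<open>f\<close> applies
      inside the composite.\<close>
    have "\<theta> Y \<cdot>\<^bsub>B\<^esub> amap T f = \<theta> Y \<cdot>\<^bsub>B\<^esub> (amap T f \<cdot>\<^bsub>B\<^esub> (\<eta> X \<cdot>\<^bsub>B\<^esub> \<theta> X))"
      unfolding \<theta>2[OF X] B.Comp_Ident_right[OF functor_Hom[OF T f]] ..
    also have "\<dots> = \<theta> Y \<cdot>\<^bsub>B\<^esub> ((\<eta> Y \<cdot>\<^bsub>B\<^esub> amap S f) \<cdot>\<^bsub>B\<^esub> \<theta> X)"
      unfolding nat[OF f] using h by (simp add: B.arr_simps)
    also have "\<dots> = (\<theta> Y \<cdot>\<^bsub>B\<^esub> \<eta> Y) \<cdot>\<^bsub>B\<^esub> (amap S f \<cdot>\<^bsub>B\<^esub> \<theta> X)"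
      using h by (simp add: B.arr_simps)
    also have "\<dots> = amap S f \<cdot>\<^bsub>B\<^esub> \<theta> X"
      unfolding \<theta>1[OF Y] by (rule B.Comp_Ident_left[OF B.Comp_in_Hom]) (use h in auto)
    finally show ?thesis .
  qed
  moreover have "is_iso B (\<theta> X)" if "X \<in> Obj A" for X
    using B.is_isoI \<theta> \<eta> \<theta>1 \<theta>2 that by blast
  ultimately have "nat_iso A B T S \<theta>"
    using S T \<theta> unfolding nat_iso_def nat_trans_def by blast
  then show thesis by (rule that)
qed

section \<open>Equivalences of categories\<close>

text \<open>Only the two natural isomorphisms are recorded, both directed towards the identity functors
  and without the triangle identities, so that the situation is symmetric in \<open>A\<close> and \<open>B\<close>.\<close>

locale equivalence_pair = A: category A + B: category B
  for A :: "('o, 'm) cat" and B :: "('p, 'n) cat" +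
  fixes F :: "('o, 'm, 'p, 'n) func" and G :: "('p, 'n, 'o, 'm) func"
    and \<epsilon> :: "'p \<Rightarrow> 'n" and \<delta> :: "'o \<Rightarrow> 'm"
  assumes F: "is_functor A B F" and G: "is_functor B A G"
    and eps: "nat_iso B B (F \<circ>\<^sub>F G) id_func \<epsilon>"
    and delta: "nat_iso A A (G \<circ>\<^sub>F F) id_func \<delta>"
begin

text \<open>Every result of this locale about \<open>F\<close> and \<epsilon> thereby holds for
  \<open>G\<close> and \<delta> too, and conversely.\<close>

lemma dual: "equivalence_pair B A G F \<delta> \<epsilon>"
  by (unfold_locales) (fact F G eps delta)+

lemma eps_Hom: "Y \<in> Obj B \<Longrightarrow> \<epsilon> Y \<in> Hom B (omap F (omap G Y)) Y"
  and eps_iso: "Y \<in> Obj B \<Longrightarrow> is_iso B (\<epsilon> Y)"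
  and eps_nat: "f \<in> Hom B X Y \<Longrightarrow> \<epsilon> Y \<cdot>\<^bsub>B\<^esub> amap F (amap G f) = f \<cdot>\<^bsub>B\<^esub> \<epsilon> X"
  using eps by (auto simp: nat_iso_def nat_trans_def comp_func_def id_func_def)

lemma eps_inverse:
  assumes "Y \<in> Obj B"
  obtains b where "b \<in> Hom B Y (omap F (omap G Y))"
    "b \<cdot>\<^bsub>B\<^esub> \<epsilon> Y = Ident B (omap F (omap G Y))" "\<epsilon> Y \<cdot>\<^bsub>B\<^esub> b = Ident B Y"
  using B.iso_inverse[OF eps_iso eps_Hom] assms by metis

text \<open>By naturality of \<epsilon>, the composite of \<open>f\<close> with
  \<open>\<epsilon> X\<close> depends on \<open>amap G f\<close> alone, and
  \<open>\<epsilon> X\<close> can be cancelled because it has a right inverse.\<close>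

lemma G_faithful:
  assumes f: "f \<in> Hom B X Y" and g: "g \<in> Hom B X Y" and eq: "amap G f = amap G g"
  shows "f = g"
proof -
  have X: "X \<in> Obj B" using B.Hom_Obj f by blast
  obtain b where b: "b \<in> Hom B X (omap F (omap G X))" "\<epsilon> X \<cdot>\<^bsub>B\<^esub> b = Ident B X"
    using eps_inverse X by metis
  have "f \<cdot>\<^bsub>B\<^esub> \<epsilon> X = g \<cdot>\<^bsub>B\<^esub> \<epsilon> X"
    using eps_nat[OF f] eps_nat[OF g] eq by simp
  then have "f \<cdot>\<^bsub>B\<^esub> (\<epsilon> X \<cdot>\<^bsub>B\<^esub> b) = g \<cdot>\<^bsub>B\<^esub> (\<epsilon> X \<cdot>\<^bsub>B\<^esub> b)"
    using B.Comp_assoc[OF b(1) eps_Hom[OF X] f] B.Comp_assoc[OF b(1) eps_Hom[OF X] g] by simp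
  then show ?thesis
    using b(2) f g by (simp add: B.Comp_Ident_right)
qed

lemmas F_faithful = equivalence_pair.G_faithful[OF dual]

text \<open>The preimage of \<open>h\<close> is the conjugate of \<open>G h\<close> by \<open>\<delta>\<close>; its image under \<open>F\<close> is compared with
  \<open>h\<close> after applying the faithful functor \<open>G\<close>.\<close>

lemma F_full:
  assumes X: "X \<in> Obj A" and Y: "Y \<in> Obj A" and h: "h \<in> Hom B (omap F X) (omap F Y)"
  obtains f where "f \<in> Hom A X Y" "amap F f = h"
proof -
  interpret D: equivalence_pair B A G F \<delta> \<epsilon> by (rule dual)
  obtain b where b: "b \<in> Hom A X (omap G (omap F X))"
    "b \<cdot>\<^bsub>A\<^esub> \<delta> X = Ident A (omap G (omap F X))"
    using D.eps_inverse X by metis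
  define f where "f = \<delta> Y \<cdot>\<^bsub>A\<^esub> (amap G h \<cdot>\<^bsub>A\<^esub> b)"
  note Gh = functor_Hom[OF G h]
  note dX = D.eps_Hom[OF X] and dY = D.eps_Hom[OF Y]
  have f: "f \<in> Hom A X Y"
    unfolding f_def using b(1) dY Gh by (simp add: A.arr_simps)
  note GFf = functor_Hom[OF G functor_Hom[OF F f]]
  have "\<delta> Y \<cdot>\<^bsub>A\<^esub> amap G (amap F f) = f \<cdot>\<^bsub>A\<^esub> \<delta> X"
    using D.eps_nat[OF f] .
  also have "\<dots> = \<delta> Y \<cdot>\<^bsub>A\<^esub> (amap G h \<cdot>\<^bsub>A\<^esub> (b \<cdot>\<^bsub>A\<^esub> \<delta> X))"
    unfolding f_def using dX dY b(1) Gh by (simp add: A.arr_simps)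
  also have "\<dots> = \<delta> Y \<cdot>\<^bsub>A\<^esub> amap G h"
    using b(2) Gh by (simp add: A.Comp_Ident_right)
  finally have "amap G (amap F f) = amap G h"
    by (rule A.mono_cancel[OF A.iso_is_mono[OF D.eps_iso[OF Y]]])
      (use GFf Gh dY in \<open>simp_all add: A.Hom_iff\<close>)
  then have "amap F f = h"
    using G_faithful functor_Hom[OF F f] h by blast
  with f show thesis by (rule that)
qed

text \<open>Up to the isomorphisms \<delta>, the arrow \<open>m\<close> agrees with its image under
  \<open>G\<close> after \<open>F\<close>, which is therefore monic. The faithful functor
  \<open>G\<close> reflects monomorphisms, so \<open>amap F m\<close> is monic.\<close>

lemma F_mono:
  assumes m: "is_mono A m"
  shows "is_mono B (amap F m)"
proof -
  interpret D: equivalence_pair B A G F \<delta> \<epsilon> by (rule dual)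
  define X Y where "X = Dom A m" and "Y = Cod A m"
  have mH: "m \<in> Hom A X Y"
    using m by (simp add: X_def Y_def is_mono_def Hom_def)
  have X: "X \<in> Obj A" and Y: "Y \<in> Obj A"
    using A.Hom_Obj mH by blast+
  note Fm = functor_Hom[OF F mH]
  note GFm = functor_Hom[OF G Fm]
  \<comment> \<open>By naturality of \<delta> this composite is also \<open>\<delta> Y\<close> after
    \<open>amap G (amap F m)\<close>, so its right factor inherits monicity.\<close>
  have "is_mono A (m \<cdot>\<^bsub>A\<^esub> \<delta> X)"
    using A.mono_Comp[OF A.iso_is_mono[OF D.eps_iso[OF X]] m] D.eps_Hom[OF X] mH
    by (simp add: Hom_def)
  then have mono: "is_mono A (amap G (amap F m))"
    using A.mono_right_factor[OF _ GFm D.eps_Hom[OF Y]] D.eps_nat[OF mH] by simp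
  show ?thesis
  proof (rule B.is_monoI)
    show "amap F m \<in> Arr B" using Fm by (simp add: Hom_def)
    fix W f g
    assume "f \<in> Hom B W (Dom B (amap F m))" "g \<in> Hom B W (Dom B (amap F m))"
      and eq: "amap F m \<cdot>\<^bsub>B\<^esub> f = amap F m \<cdot>\<^bsub>B\<^esub> g"
    then have fg: "f \<in> Hom B W (omap F X)" "g \<in> Hom B W (omap F X)"
      using Fm by (simp_all add: Hom_def)
    have "amap G (amap F m) \<cdot>\<^bsub>A\<^esub> amap G f = amap G (amap F m) \<cdot>\<^bsub>A\<^esub> amap G g"
      using functor_Comp[OF G fg(1) Fm] functor_Comp[OF G fg(2) Fm] eq by simp
    then have "amap G f = amap G g"
      by (rule A.mono_cancel[OF mono])
        (use functor_Hom[OF G fg(1)] functor_Hom[OF G fg(2)] GFm in \<open>simp_all add: A.Hom_iff\<close>)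
    then show "f = g" using G_faithful fg by blast
  qed
qed

end

text \<open>In an equivalence the isomorphism \<alpha> starts at the identity functor, so its
  inverse supplies \<delta>. The quasi-inverse found here need not be a given right adjoint of
  \<open>F\<close>.\<close>

lemma is_equivalence_pair:
  assumes "category A" "category B" "is_equivalence A B F"
  obtains G \<epsilon> \<delta> where "equivalence_pair A B F G \<epsilon> \<delta>"
proof -
  obtain G \<alpha> \<beta> where G: "is_functor A B F" "is_functor B A G"
    "nat_iso A A id_func (G \<circ>\<^sub>F F) \<alpha>" "nat_iso B B (F \<circ>\<^sub>F G) id_func \<beta>"
    using assms(3) unfolding is_equivalence_def by blast
  obtain \<delta> where "nat_iso A A (G \<circ>\<^sub>F F) id_func \<delta>"
    using nat_iso_inverse[OF assms(1,1) G(3)] .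
  then show thesis
    using that G assms(1,2) by (simp add: equivalence_pair_def equivalence_pair_axioms_def)
qed

text \<open>Some quasi-inverse \<open>G'\<close> makes \<open>F\<close> full and faithful. This
  forces the unit of the given adjunction to be invertible, and the counit at each
  \<open>omap F X\<close>. The counit is then invertible everywhere, since each object of
  \<open>B\<close> is isomorphic to some \<open>omap F X\<close>.\<close>

lemma equivalence_adjunction_pair:
  assumes "category A" "category B" "is_equivalence A B F" "is_adjunction A B F G \<eta> \<epsilon>"
  obtains \<delta> where "equivalence_pair A B F G \<epsilon> \<delta>"
proof -
  interpret A: category A by fact
  interpret B: category B by fact
  obtain G' \<epsilon>' \<delta>' where "equivalence_pair A B F G' \<epsilon>' \<delta>'"
    using is_equivalence_pair[OF assms(1-3)] .
  then interpret E: equivalence_pair A B F G' \<epsilon>' \<delta>' .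
  have F: "is_functor A B F" and G: "is_functor B A G"
    and \<eta>N: "nat_trans A A id_func (G \<circ>\<^sub>F F) \<eta>" and \<epsilon>N: "nat_trans B B (F \<circ>\<^sub>F G) id_func \<epsilon>"
    and tri1: "\<And>X. X \<in> Obj A \<Longrightarrow> \<epsilon> (omap F X) \<cdot>\<^bsub>B\<^esub> amap F (\<eta> X) = Ident B (omap F X)"
    and tri2: "\<And>Y. Y \<in> Obj B \<Longrightarrow> amap G (\<epsilon> Y) \<cdot>\<^bsub>A\<^esub> \<eta> (omap G Y) = Ident A (omap G Y)"
    using assms(4) unfolding is_adjunction_def by auto
  have \<eta>: "\<And>X. X \<in> Obj A \<Longrightarrow> \<eta> X \<in> Hom A X (omap G (omap F X))"
    and \<eta>_nat: "\<And>X Y f. f \<in> Hom A X Y \<Longrightarrow> \<eta> Y \<cdot>\<^bsub>A\<^esub> f = amap G (amap F f) \<cdot>\<^bsub>A\<^esub> \<eta> X"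
    using \<eta>N by (auto simp: nat_trans_def comp_func_def id_func_def)
  have \<epsilon>: "\<And>Y. Y \<in> Obj B \<Longrightarrow> \<epsilon> Y \<in> Hom B (omap F (omap G Y)) Y"
    and \<epsilon>_nat: "\<And>X Y f. f \<in> Hom B X Y \<Longrightarrow> \<epsilon> Y \<cdot>\<^bsub>B\<^esub> amap F (amap G f) = f \<cdot>\<^bsub>B\<^esub> \<epsilon> X"
    using \<epsilon>N by (auto simp: nat_trans_def comp_func_def id_func_def)
  \<comment> \<open>Transposition of \<open>h\<close> along the adjunction has a left inverse, by
    naturality of \<eta> and the second triangle identity. Hence arrows with the same transpose are
    equal.\<close>
  have transpose: "amap G (\<epsilon> Y \<cdot>\<^bsub>B\<^esub> amap F h) \<cdot>\<^bsub>A\<^esub> \<eta> X = h"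
    if Y: "Y \<in> Obj B" and h: "h \<in> Hom A X (omap G Y)" for X Y h
  proof -
    have X: "X \<in> Obj A" using A.Hom_Obj h by blast
    note GY = functor_Obj[OF G Y]
    note Fh = functor_Hom[OF F h]
    have "amap G (\<epsilon> Y \<cdot>\<^bsub>B\<^esub> amap F h) \<cdot>\<^bsub>A\<^esub> \<eta> X
        = amap G (\<epsilon> Y) \<cdot>\<^bsub>A\<^esub> (amap G (amap F h) \<cdot>\<^bsub>A\<^esub> \<eta> X)"
      using functor_Comp[OF G Fh \<epsilon>[OF Y]] functor_Hom[OF G Fh] functor_Hom[OF G \<epsilon>[OF Y]] \<eta>[OF X]
      by (simp add: A.arr_simps)
    also have "\<dots> = (amap G (\<epsilon> Y) \<cdot>\<^bsub>A\<^esub> \<eta> (omap G Y)) \<cdot>\<^bsub>A\<^esub> h"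
      unfolding \<eta>_nat[OF h, symmetric] using functor_Hom[OF G \<epsilon>[OF Y]] \<eta>[OF GY] h
      by (simp add: A.arr_simps)
    also have "\<dots> = h"
      using tri2[OF Y] h by (simp add: A.Comp_Ident_left)
    finally show ?thesis .
  qed
  text \<open>Writing \<open>\<epsilon>\<^sub>F\<^sub>X = F e\<close> by fullness, \<open>e\<close> is inverse to \<open>\<eta>\<^sub>X\<close>: on one side by faithfulness, on the
    other because \<open>\<eta>\<^sub>X \<cdot> e\<close> and the identity have the same transpose.\<close>
  have isos: "is_iso A (\<eta> X) \<and> is_iso B (\<epsilon> (omap F X))" if X: "X \<in> Obj A" for X
  proof -
    note FX = functor_Obj[OF F X]
    note GFX = functor_Obj[OF G FX]
    obtain e where e: "e \<in> Hom A (omap G (omap F X)) X" "amap F e = \<epsilon> (omap F X)"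
      using E.F_full[OF GFX X \<epsilon>[OF FX]] .
    have "amap F (e \<cdot>\<^bsub>A\<^esub> \<eta> X) = amap F (Ident A X)"
      using functor_Comp[OF F \<eta>[OF X] e(1)] e(2) tri1[OF X] functor_Ident[OF F X] by simp
    then have 1: "e \<cdot>\<^bsub>A\<^esub> \<eta> X = Ident A X"
      using E.F_faithful A.Comp_in_Hom[OF \<eta>[OF X] e(1)] A.Ident_in_Hom[OF X] by blast
    have \<eta>e: "\<eta> X \<cdot>\<^bsub>A\<^esub> e \<in> Hom A (omap G (omap F X)) (omap G (omap F X))"
      using A.Comp_in_Hom[OF e(1) \<eta>[OF X]] .
    note I = A.Ident_in_Hom[OF GFX]
    have "\<epsilon> (omap F X) \<cdot>\<^bsub>B\<^esub> amap F (\<eta> X \<cdot>\<^bsub>A\<^esub> e)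
        = (\<epsilon> (omap F X) \<cdot>\<^bsub>B\<^esub> amap F (\<eta> X)) \<cdot>\<^bsub>B\<^esub> amap F e"
      using functor_Comp[OF F e(1) \<eta>[OF X]] functor_Hom[OF F e(1)] functor_Hom[OF F \<eta>[OF X]]
        \<epsilon>[OF FX] by (simp add: B.arr_simps)
    also have "\<dots> = \<epsilon> (omap F X)"
      using tri1[OF X] e(2) \<epsilon>[OF FX] by (simp add: B.Comp_Ident_left)
    also have "\<dots> = \<epsilon> (omap F X) \<cdot>\<^bsub>B\<^esub> amap F (Ident A (omap G (omap F X)))"
      using functor_Ident[OF F GFX] \<epsilon>[OF FX] by (simp add: B.Comp_Ident_right)
    finally have eq: "\<epsilon> (omap F X) \<cdot>\<^bsub>B\<^esub> amap F (\<eta> X \<cdot>\<^bsub>A\<^esub> e)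
        = \<epsilon> (omap F X) \<cdot>\<^bsub>B\<^esub> amap F (Ident A (omap G (omap F X)))" .
    have 2: "\<eta> X \<cdot>\<^bsub>A\<^esub> e = Ident A (omap G (omap F X))"
      by (rule transpose[OF FX \<eta>e, unfolded eq, unfolded transpose[OF FX I], symmetric])
    have "is_iso A e" "is_iso A (\<eta> X)"
      by (rule A.is_isoI[OF e(1) \<eta>[OF X] 2 1], rule A.is_isoI[OF \<eta>[OF X] e(1) 1 2])
    then show ?thesis
      using functor_iso[OF assms(1,2) F _ e(1)] e(2) by simp
  qed
  \<comment> \<open>The arrow \<open>\<epsilon>' Y\<close> joins \<open>Y\<close> to an object in
    the image of \<open>F\<close>, where the counit is already invertible. The naturality square of
    \<epsilon> at this arrow is solved for \<open>\<epsilon> Y\<close>.\<close>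
  have \<epsilon>_iso: "is_iso B (\<epsilon> Y)" if Y: "Y \<in> Obj B" for Y
  proof -
    define X where "X = omap G' Y"
    have X: "X \<in> Obj A" unfolding X_def using functor_Obj[OF E.G Y] .
    note FX = functor_Obj[OF F X]
    note y = E.eps_Hom[OF Y, folded X_def]
    note FGy = functor_Hom[OF F functor_Hom[OF G y]]
    have FGy_iso: "is_iso B (amap F (amap G (\<epsilon>' Y)))"
      using functor_iso[OF assms(1,2) F functor_iso[OF assms(2,1) G E.eps_iso[OF Y] y]
          functor_Hom[OF G y]] .
    obtain b where b: "b \<in> Hom B (omap F (omap G Y)) (omap F (omap G (omap F X)))"
      "b \<cdot>\<^bsub>B\<^esub> amap F (amap G (\<epsilon>' Y)) = Ident B (omap F (omap G (omap F X)))"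
      "amap F (amap G (\<epsilon>' Y)) \<cdot>\<^bsub>B\<^esub> b = Ident B (omap F (omap G Y))"
      using B.iso_inverse[OF FGy_iso FGy] .
    have b_iso: "is_iso B b"
      using B.is_isoI[OF b(1) FGy b(3,2)] .
    have "\<epsilon> Y = (\<epsilon> Y \<cdot>\<^bsub>B\<^esub> amap F (amap G (\<epsilon>' Y))) \<cdot>\<^bsub>B\<^esub> b"
      unfolding B.Comp_assoc[OF b(1) FGy \<epsilon>[OF Y]] b(3) B.Comp_Ident_right[OF \<epsilon>[OF Y]] ..
    also have "\<dots> = (\<epsilon>' Y \<cdot>\<^bsub>B\<^esub> \<epsilon> (omap F X)) \<cdot>\<^bsub>B\<^esub> b"
      using \<epsilon>_nat[OF y] by simp
    finally show ?thesis
      using B.iso_Comp[OF b_iso b(1) B.iso_Comp[OF _ \<epsilon>[OF FX] E.eps_iso[OF Y] y]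
          B.Comp_in_Hom[OF \<epsilon>[OF FX] y]] isos[OF X] by simp
  qed
  have "nat_iso A A id_func (G \<circ>\<^sub>F F) \<eta>"
    using \<eta>N isos by (simp add: nat_iso_def)
  then obtain \<delta> where "nat_iso A A (G \<circ>\<^sub>F F) id_func \<delta>"
    using nat_iso_inverse[OF assms(1,1)] by blast
  moreover have "nat_iso B B (F \<circ>\<^sub>F G) id_func \<epsilon>"
    using \<epsilon>N \<epsilon>_iso by (simp add: nat_iso_def)
  ultimately show thesis
    using that F G assms(1,2) by (simp add: equivalence_pair_def equivalence_pair_axioms_def)
qed

section \<open>Preradicals\<close>

lemma mono_transD:
  assumes "(T, \<tau>) \<in> mono_trans A"
  shows "is_functor A A T" "X \<in> Obj A \<Longrightarrow> \<tau> X \<in> Hom A (omap T X) X" "X \<in> Obj A \<Longrightarrow> is_mono A (\<tau> X)"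
    "f \<in> Hom A X Y \<Longrightarrow> \<tau> Y \<cdot>\<^bsub>A\<^esub> amap T f = f \<cdot>\<^bsub>A\<^esub> \<tau> X"
  using assms by (auto simp: mono_trans_def nat_trans_def id_func_def)

context category
begin

text \<open>Naturality of a factorization through a monomorphic transformation is automatic.\<close>

lemma factors_iff:
  assumes T: "(T, \<tau>) \<in> mono_trans C" and S: "(S, \<sigma>) \<in> mono_trans C"
  shows "factors C (T, \<tau>) (S, \<sigma>) \<longleftrightarrow>
    (\<forall>X \<in> Obj C. \<exists>u \<in> Hom C (omap T X) (omap S X). \<tau> X = \<sigma> X \<cdot> u)"
proof
  show "factors C (T, \<tau>) (S, \<sigma>) \<Longrightarrow>
    \<forall>X \<in> Obj C. \<exists>u \<in> Hom C (omap T X) (omap S X). \<tau> X = \<sigma> X \<cdot> u"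
    unfolding factors_def nat_trans_def by auto
next
  assume "\<forall>X \<in> Obj C. \<exists>u \<in> Hom C (omap T X) (omap S X). \<tau> X = \<sigma> X \<cdot> u"
  then obtain \<theta> where \<theta>: "\<And>X. X \<in> Obj C \<Longrightarrow> \<theta> X \<in> Hom C (omap T X) (omap S X)"
    and eq: "\<And>X. X \<in> Obj C \<Longrightarrow> \<tau> X = \<sigma> X \<cdot> \<theta> X"
    by metis
  have "\<theta> Y \<cdot> amap T f = amap S f \<cdot> \<theta> X" if f: "f \<in> Hom C X Y" for f X Y
  proof -
    have X: "X \<in> Obj C" and Y: "Y \<in> Obj C"
      using Hom_Obj f by blast+
    note h = functor_Hom[OF mono_transD(1)[OF T] f] functor_Hom[OF mono_transD(1)[OF S] f]
      \<theta>[OF X] \<theta>[OF Y] mono_transD(2)[OF S X] mono_transD(2)[OF S Y] f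
    \<comment> \<open>Both sides of the required square become \<open>f\<close> after
      \<open>\<tau> X\<close> once composed with \<open>\<sigma> Y\<close>, and
      \<open>\<sigma> Y\<close> is monic.\<close>
    have "\<sigma> Y \<cdot> (\<theta> Y \<cdot> amap T f) = \<tau> Y \<cdot> amap T f"
      unfolding eq[OF Y] using h by (simp add: arr_simps)
    also have "\<dots> = f \<cdot> \<tau> X"
      using mono_transD(4)[OF T f] .
    also have "\<dots> = (f \<cdot> \<sigma> X) \<cdot> \<theta> X"
      unfolding eq[OF X] using h by (simp add: arr_simps)
    also have "\<dots> = \<sigma> Y \<cdot> (amap S f \<cdot> \<theta> X)"
      unfolding mono_transD(4)[OF S f, symmetric] using h by (simp add: arr_simps)
    finally show ?thesis
      by (rule mono_cancel[OF mono_transD(3)[OF S Y]]) (use h in \<open>simp_all add: arr_simps\<close>)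
  qed
  then have "nat_trans C C T S \<theta>"
    using \<theta> mono_transD(1)[OF T] mono_transD(1)[OF S] unfolding nat_trans_def by blast
  then show "factors C (T, \<tau>) (S, \<sigma>)"
    using eq unfolding factors_def by blast
qed

section \<open>Classes of monomorphic transformations and their order\<close>

lemma factors_refl:
  assumes "p \<in> mono_trans C"
  shows "factors C p p"
proof -
  obtain T \<tau> where p: "p = (T, \<tau>)" by (cases p)
  note T = assms[unfolded p]
  show ?thesis
    unfolding p factors_iff[OF T T]
    using Ident_in_Hom[OF functor_Obj[OF mono_transD(1)[OF T]]]
      Comp_Ident_right[OF mono_transD(2)[OF T]] by metis
qed

lemma factors_trans:
  assumes "p \<in> mono_trans C" "q \<in> mono_trans C" "r \<in> mono_trans C"
    and "factors C p q" "factors C q r"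
  shows "factors C p r"
proof -
  obtain T \<tau> S \<sigma> R \<rho> where pqr: "p = (T, \<tau>)" "q = (S, \<sigma>)" "r = (R, \<rho>)"
    by (metis surj_pair)
  note mono = assms(1-3)[unfolded pqr]
  have "\<exists>u \<in> Hom C (omap T X) (omap R X). \<tau> X = \<rho> X \<cdot> u" if X: "X \<in> Obj C" for X
  proof -
    obtain u where u: "u \<in> Hom C (omap T X) (omap S X)" "\<tau> X = \<sigma> X \<cdot> u"
      using factors_iff mono assms(4) pqr X by blast
    obtain v where v: "v \<in> Hom C (omap S X) (omap R X)" "\<sigma> X = \<rho> X \<cdot> v"
      using factors_iff mono assms(5) pqr X by blast
    have "\<tau> X = \<rho> X \<cdot> (v \<cdot> u)"
      unfolding u(2) v(2) using u(1) v(1) mono_transD(2)[OF mono(3) X] by (simp add: arr_simps)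
    then show ?thesis
      using Comp_in_Hom[OF u(1) v(1)] by blast
  qed
  then show ?thesis
    using factors_iff mono pqr by blast
qed

lemma equiv_same_subobject: "equiv (mono_trans C) (same_subobject C)"
proof (rule equivI)
  show "refl_on (mono_trans C) (same_subobject C)"
    using factors_refl by (auto simp: refl_on_def same_subobject_def)
  show "same_subobject C \<subseteq> mono_trans C \<times> mono_trans C"
    by (auto simp: same_subobject_def)
  show "sym (same_subobject C)"
    by (auto simp: sym_def same_subobject_def)
  show "trans (same_subobject C)"
    using factors_trans unfolding trans_def same_subobject_def by blast
qed

lemma preradical_eq_iff:
  "\<lbrakk>p \<in> mono_trans C; q \<in> mono_trans C\<rbrakk>
    \<Longrightarrow> preradical C p = preradical C q \<longleftrightarrow> factors C p q \<and> factors C q p"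
  unfolding preradical_def using eq_equiv_class_iff[OF equiv_same_subobject]
  by (simp add: same_subobject_def)

lemma mem_preradical:
  "p \<in> mono_trans C \<Longrightarrow> q \<in> preradical C p \<longleftrightarrow> q \<in> mono_trans C \<and> factors C p q \<and> factors C q p"
  by (auto simp: preradical_def same_subobject_def)

lemma Pr_eq: "Pr C = preradical C ` mono_trans C"
  by (auto simp: Pr_def preradical_def quotient_def)

text \<open>The order asks for one comparable pair of representatives; by transitivity the chosen
  pair then compares as well.\<close>

lemma Pr_le_preradical:
  assumes "p \<in> mono_trans C" "q \<in> mono_trans C"
  shows "Pr_le C (preradical C p) (preradical C q) \<longleftrightarrow> factors C p q"
  unfolding Pr_le_def using assms factors_trans factors_refl by (meson mem_preradical)

text \<open>At each object, being an image of a monomorphism means mutual factorization with it.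
  Such pointwise factorizations are automatically natural, so all choices of an image functor
  together form the whole class.\<close>

lemma Im_trans_mono:
  assumes "abelian_category C" "(T, \<tau>) \<in> mono_trans C"
  shows "Im_trans C \<tau> = preradical C (T, \<tau>)"
proof -
  have "(\<forall>Y \<in> Obj C. is_image C (\<tau> Y) (\<iota> Y)) \<longleftrightarrow>
      factors C (T, \<tau>) (I, \<iota>) \<and> factors C (I, \<iota>) (T, \<tau>)" if "(I, \<iota>) \<in> mono_trans C" for I \<iota>
    unfolding factors_iff[OF assms(2) that] factors_iff[OF that assms(2)]
    using is_image_mono_iff[OF assms(1)] mono_transD[OF assms(2)] mono_transD[OF that] by blast
  then show ?thesis
    using mem_preradical[OF assms(2)] by (auto simp: Im_trans_def)
qed

end

section \<open>Transport of representatives along an equivalence\<close>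

definition transport where
  "transport B F G \<epsilon> p = (F \<circ>\<^sub>F fst p \<circ>\<^sub>F G, transported B F G \<epsilon> (snd p))"

context equivalence_pair
begin

lemma transported_Hom:
  assumes "(T, \<tau>) \<in> mono_trans A" "Y \<in> Obj B"
  shows "amap F (\<tau> (omap G Y)) \<in> Hom B (omap F (omap T (omap G Y))) (omap F (omap G Y))"
    "transported B F G \<epsilon> \<tau> Y \<in> Hom B (omap F (omap T (omap G Y))) Y"
  unfolding transported_def
  using functor_Hom[OF F mono_transD(2)[OF assms(1) functor_Obj[OF G assms(2)]]]
    eps_Hom[OF assms(2)] B.Comp_in_Hom by blast+

text \<open>Since \<open>F\<close> preserves monomorphisms and \<epsilon> is invertible, the
  composite is monic before any image is taken. Its naturality combines the square of \<tau> at
  \<open>amap G f\<close> with that of \<epsilon> at \<open>f\<close>.\<close>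

lemma transport_mono_trans:
  assumes "p \<in> mono_trans A"
  shows "transport B F G \<epsilon> p \<in> mono_trans B"
proof -
  obtain T \<tau> where p: "p = (T, \<tau>)" by (cases p)
  note T = assms[unfolded p]
  have "is_functor B B (F \<circ>\<^sub>F T \<circ>\<^sub>F G)"
    using functor_comp_func[OF functor_comp_func[OF G mono_transD(1)[OF T]] F] .
  moreover have "transported B F G \<epsilon> \<tau> Y' \<cdot>\<^bsub>B\<^esub> amap F (amap T (amap G f))
      = f \<cdot>\<^bsub>B\<^esub> transported B F G \<epsilon> \<tau> Y" if f: "f \<in> Hom B Y Y'" for f Y Y'
  proof -
    have Y: "Y \<in> Obj B" "Y' \<in> Obj B"
      using B.Hom_Obj f by blast+
    note Gf = functor_Hom[OF G f]
    note TGf = functor_Hom[OF mono_transD(1)[OF T] Gf]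
    note tY = mono_transD(2)[OF T functor_Obj[OF G Y(1)]]
      and tY' = mono_transD(2)[OF T functor_Obj[OF G Y(2)]]
    note h = f functor_Hom[OF F Gf] functor_Hom[OF F TGf] functor_Hom[OF F tY]
      functor_Hom[OF F tY'] eps_Hom[OF Y(1)] eps_Hom[OF Y(2)]
    have "transported B F G \<epsilon> \<tau> Y' \<cdot>\<^bsub>B\<^esub> amap F (amap T (amap G f))
        = \<epsilon> Y' \<cdot>\<^bsub>B\<^esub> (amap F (\<tau> (omap G Y')) \<cdot>\<^bsub>B\<^esub> amap F (amap T (amap G f)))"
      unfolding transported_def using h by (simp add: B.arr_simps)
    also have "\<dots> = \<epsilon> Y' \<cdot>\<^bsub>B\<^esub> amap F (\<tau> (omap G Y') \<cdot>\<^bsub>A\<^esub> amap T (amap G f))"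
      using functor_Comp[OF F TGf tY'] by simp
    also have "\<dots> = \<epsilon> Y' \<cdot>\<^bsub>B\<^esub> (amap F (amap G f) \<cdot>\<^bsub>B\<^esub> amap F (\<tau> (omap G Y)))"
      using mono_transD(4)[OF T Gf] functor_Comp[OF F tY Gf] by simp
    also have "\<dots> = (\<epsilon> Y' \<cdot>\<^bsub>B\<^esub> amap F (amap G f)) \<cdot>\<^bsub>B\<^esub> amap F (\<tau> (omap G Y))"
      using h by (simp add: B.arr_simps)
    also have "\<dots> = f \<cdot>\<^bsub>B\<^esub> transported B F G \<epsilon> \<tau> Y"
      unfolding eps_nat[OF f] transported_def using h by (simp add: B.arr_simps)
    finally show ?thesis .
  qed
  moreover have "is_mono B (transported B F G \<epsilon> \<tau> Y)" if Y: "Y \<in> Obj B" for Y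
    unfolding transported_def
    using B.mono_Comp[OF F_mono[OF mono_transD(3)[OF T functor_Obj[OF G Y]]]
        B.iso_is_mono[OF eps_iso[OF Y]]]
      transported_Hom(1)[OF T Y] eps_Hom[OF Y] by (simp add: Hom_def)
  ultimately show ?thesis
    using transported_Hom(2)[OF T] functor_id_func[of B]
    by (simp add: p transport_def mono_trans_def nat_trans_def comp_func_def id_func_def)
qed

text \<open>A factorization at \<open>omap G Y\<close> is carried by \<open>F\<close> to one at
  \<open>Y\<close>; composing with \<open>\<epsilon> Y\<close> on the left does not disturb
  it.\<close>

lemma transport_factors:
  assumes "p \<in> mono_trans A" "q \<in> mono_trans A" "factors A p q"
  shows "factors B (transport B F G \<epsilon> p) (transport B F G \<epsilon> q)"
proof -
  obtain T \<tau> S \<sigma> where p: "p = (T, \<tau>)" and q: "q = (S, \<sigma>)" by (metis surj_pair)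
  note T = assms(1)[unfolded p] and S = assms(2)[unfolded q]
  have "\<exists>u \<in> Hom B (omap F (omap T (omap G Y))) (omap F (omap S (omap G Y))).
      transported B F G \<epsilon> \<tau> Y = transported B F G \<epsilon> \<sigma> Y \<cdot>\<^bsub>B\<^esub> u" if Y: "Y \<in> Obj B" for Y
  proof -
    note GY = functor_Obj[OF G Y]
    obtain u where u: "u \<in> Hom A (omap T (omap G Y)) (omap S (omap G Y))"
      "\<tau> (omap G Y) = \<sigma> (omap G Y) \<cdot>\<^bsub>A\<^esub> u"
      using A.factors_iff[OF T S] assms(3) p q GY by blast
    have "transported B F G \<epsilon> \<tau> Y = transported B F G \<epsilon> \<sigma> Y \<cdot>\<^bsub>B\<^esub> amap F u"
      unfolding transported_def u(2) functor_Comp[OF F u(1) mono_transD(2)[OF S GY]]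
      using functor_Hom[OF F u(1)] transported_Hom(1)[OF S Y] eps_Hom[OF Y]
      by (simp add: B.arr_simps)
    then show ?thesis
      using functor_Hom[OF F u(1)] by blast
  qed
  then show ?thesis
    using B.factors_iff transport_mono_trans[OF assms(1)] transport_mono_trans[OF assms(2)]
    by (simp add: p q transport_def comp_func_def)
qed

text \<open>The round trip changes \<sigma> only by isomorphisms: one at the source, and one between
  the objects at which \<sigma> is evaluated, which naturality of \<sigma> moves to the source as
  well.\<close>

lemma transport_transport:
  assumes "q \<in> mono_trans B"
  shows "factors B (transport B F G \<epsilon> (transport A G F \<delta> q)) q"
    and "factors B q (transport B F G \<epsilon> (transport A G F \<delta> q))"
proof -
  interpret D: equivalence_pair B A G F \<delta> \<epsilon> by (rule dual)
  obtain S \<sigma> where q: "q = (S, \<sigma>)" by (cases q)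
  note S = assms[unfolded q]
  note SF = mono_transD(1)[OF S]
  define \<rho> where "\<rho> = transported B F G \<epsilon> (transported A G F \<delta> \<sigma>)"
  define R where "R = F \<circ>\<^sub>F (G \<circ>\<^sub>F S \<circ>\<^sub>F F) \<circ>\<^sub>F G"
  have R: "transport B F G \<epsilon> (transport A G F \<delta> q) = (R, \<rho>)"
    by (simp add: transport_def q \<rho>_def R_def)
  have R_mem: "(R, \<rho>) \<in> mono_trans B"
    using transport_mono_trans[OF D.transport_mono_trans[OF assms]] R by simp
  \<comment> \<open>A single isomorphism serves both claims: \<open>c\<close> gives one
    factorization and its inverse the other.\<close>
  have iso: "\<exists>c. is_iso B c \<and> c \<in> Hom B (omap R Y) (omap S Y) \<and> \<rho> Y = \<sigma> Y \<cdot>\<^bsub>B\<^esub> c"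
    if Y: "Y \<in> Obj B" for Y
  proof -
    \<comment> \<open>The inner transport, taken at \<open>omap G Y\<close>, evaluates \<sigma> at
      this object.\<close>
    define Z where "Z = omap F (omap G Y)"
    note GY = functor_Obj[OF G Y]
    have Z: "Z \<in> Obj B" unfolding Z_def by (rule functor_Obj[OF F GY])
    note SZ = functor_Obj[OF SF Z]
    note sZ = mono_transD(2)[OF S Z] and sY = mono_transD(2)[OF S Y]
    note eY = eps_Hom[OF Y, folded Z_def] and eZ = eps_Hom[OF Z] and eSZ = eps_Hom[OF SZ]
    note d = D.eps_Hom[OF GY, folded Z_def]
    note Fd = functor_Hom[OF F d, folded Z_def]
    obtain b where b: "b \<in> Hom B Z (omap F (omap G Z))"
      "b \<cdot>\<^bsub>B\<^esub> \<epsilon> Z = Ident B (omap F (omap G Z))" "\<epsilon> Z \<cdot>\<^bsub>B\<^esub> b = Ident B Z"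
      using eps_inverse[OF Z] .
    \<comment> \<open>Inserting \<open>b\<close> after \<open>\<epsilon> Z\<close> into
      \<open>\<rho> Y\<close> lets naturality of \<epsilon> replace the image of
      \<open>\<sigma> Z\<close> under \<open>G\<close> and \<open>F\<close> by
      \<open>\<sigma> Z\<close> itself. What remains to its left is \<open>a\<close>.\<close>
    define a where "a = \<epsilon> Y \<cdot>\<^bsub>B\<^esub> (amap F (\<delta> (omap G Y)) \<cdot>\<^bsub>B\<^esub> b)"
    have Fdb: "amap F (\<delta> (omap G Y)) \<cdot>\<^bsub>B\<^esub> b \<in> Hom B Z Z"
      using B.Comp_in_Hom[OF b(1) Fd] .
    have a: "a \<in> Hom B Z Y"
      unfolding a_def using B.Comp_in_Hom[OF Fdb eY] .
    have "is_iso B b" using B.is_isoI[OF b(1) eZ b(3,2)] .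
    moreover have "is_iso B (amap F (\<delta> (omap G Y)))"
      using functor_iso[OF A.category_axioms B.category_axioms F D.eps_iso[OF GY] D.eps_Hom[OF GY]] .
    ultimately have a_iso: "is_iso B a"
      unfolding a_def using B.iso_Comp b(1) Fd eY eps_iso[OF Y] Fdb by blast
    note Sa = functor_Hom[OF SF a]
    \<comment> \<open>Naturality of \<sigma> at \<open>a\<close> turns \<open>a\<close> after
      \<open>\<sigma> Z\<close> into \<open>\<sigma> Y\<close> after \<open>amap S a\<close>;
      \<open>c\<close> collects everything to the right of \<open>\<sigma> Y\<close>.\<close>
    define c where "c = amap S a \<cdot>\<^bsub>B\<^esub> \<epsilon> (omap S Z)"
    have "is_iso B c"
      unfolding c_def
      using B.iso_Comp[OF eps_iso[OF SZ] eSZ functor_iso[OF B.category_axioms B.category_axioms SF a_iso a] Sa] .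
    moreover have "c \<in> Hom B (omap R Y) (omap S Y)"
      using B.Comp_in_Hom[OF eSZ Sa] by (simp add: c_def R_def comp_func_def Z_def)
    moreover have "\<rho> Y = \<sigma> Y \<cdot>\<^bsub>B\<^esub> c"
    proof -
      note Gs = functor_Hom[OF G sZ]
      note FGs = functor_Hom[OF F Gs]
      have "\<rho> Y = \<epsilon> Y \<cdot>\<^bsub>B\<^esub> (amap F (\<delta> (omap G Y)) \<cdot>\<^bsub>B\<^esub> amap F (amap G (\<sigma> Z)))"
        unfolding \<rho>_def transported_def using functor_Comp[OF F Gs d] by (simp add: Z_def)
      also have "\<dots> = \<epsilon> Y \<cdot>\<^bsub>B\<^esub> (amap F (\<delta> (omap G Y)) \<cdot>\<^bsub>B\<^esub> ((b \<cdot>\<^bsub>B\<^esub> \<epsilon> Z) \<cdot>\<^bsub>B\<^esub> amap F (amap G (\<sigma> Z))))"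
        unfolding b(2) B.Comp_Ident_left[OF FGs] ..
      also have "\<dots> = a \<cdot>\<^bsub>B\<^esub> (\<epsilon> Z \<cdot>\<^bsub>B\<^esub> amap F (amap G (\<sigma> Z)))"
        unfolding a_def using b(1) eY eZ Fd FGs by (simp add: B.arr_simps)
      also have "\<dots> = (a \<cdot>\<^bsub>B\<^esub> \<sigma> Z) \<cdot>\<^bsub>B\<^esub> \<epsilon> (omap S Z)"
        unfolding eps_nat[OF sZ] using a sZ eSZ by (simp add: B.arr_simps)
      also have "\<dots> = \<sigma> Y \<cdot>\<^bsub>B\<^esub> c"
        unfolding c_def mono_transD(4)[OF S a, symmetric] using sY Sa eSZ by (simp add: B.arr_simps)
      finally show ?thesis .
    qed
    ultimately show ?thesis by blast
  qed
  then show "factors B (transport B F G \<epsilon> (transport A G F \<delta> q)) q"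
    unfolding R unfolding q B.factors_iff[OF R_mem S] by blast
  have "\<exists>u \<in> Hom B (omap S Y) (omap R Y). \<sigma> Y = \<rho> Y \<cdot>\<^bsub>B\<^esub> u" if Y: "Y \<in> Obj B" for Y
  proof -
    obtain c where c: "is_iso B c" "c \<in> Hom B (omap R Y) (omap S Y)" "\<rho> Y = \<sigma> Y \<cdot>\<^bsub>B\<^esub> c"
      using iso[OF Y] by blast
    obtain u where u: "u \<in> Hom B (omap S Y) (omap R Y)" "c \<cdot>\<^bsub>B\<^esub> u = Ident B (omap S Y)"
      using B.iso_inverse[OF c(1,2)] .
    note sY = mono_transD(2)[OF S Y]
    have "\<sigma> Y = \<rho> Y \<cdot>\<^bsub>B\<^esub> u"
      unfolding c(3) B.Comp_assoc[OF u(1) c(2) sY] u(2) B.Comp_Ident_right[OF sY] ..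
    then show ?thesis using u(1) by blast
  qed
  then show "factors B q (transport B F G \<epsilon> (transport A G F \<delta> q))"
    unfolding R unfolding q B.factors_iff[OF S R_mem] by blast
qed

text \<open>To reflect a factorization, transport it back to \<open>A\<close> and compare both ends
  with \<open>p\<close> and \<open>q\<close> through the round trip there.\<close>

lemma transport_factors_iff:
  assumes p: "p \<in> mono_trans A" and q: "q \<in> mono_trans A"
  shows "factors B (transport B F G \<epsilon> p) (transport B F G \<epsilon> q) \<longleftrightarrow> factors A p q"
proof
  interpret D: equivalence_pair B A G F \<delta> \<epsilon> by (rule dual)
  let ?p = "transport B F G \<epsilon> p" and ?q = "transport B F G \<epsilon> q"
  assume "factors B ?p ?q"
  then have *: "factors A (transport A G F \<delta> ?p) (transport A G F \<delta> ?q)"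
    using D.transport_factors transport_mono_trans p q by blast
  have mem: "transport A G F \<delta> ?p \<in> mono_trans A" "transport A G F \<delta> ?q \<in> mono_trans A"
    using D.transport_mono_trans transport_mono_trans p q by blast+
  have "factors A p (transport A G F \<delta> ?q)"
    using A.factors_trans[OF p mem D.transport_transport(2)[OF p] *] .
  then show "factors A p q"
    using A.factors_trans[OF p mem(2) q _ D.transport_transport(1)[OF q]] by blast
qed (rule transport_factors[OF p q])

section \<open>The induced map on preradicals\<close>

lemma induced_map_preradical:
  assumes "abelian_category B" "p \<in> mono_trans A"
  shows "induced_map B F G \<epsilon> (preradical A p) = preradical B (transport B F G \<epsilon> p)"
proof -
  \<comment> \<open>All members of the union coincide: the image class of a monic composite is its
    own class, and equivalent representatives have equivalent transports.\<close>
  have "Im_trans B (transported B F G \<epsilon> \<tau>) = preradical B (transport B F G \<epsilon> p)"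
    if "(T, \<tau>) \<in> preradical A p" for T \<tau>
  proof -
    have T: "(T, \<tau>) \<in> mono_trans A" "factors A p (T, \<tau>)" "factors A (T, \<tau>) p"
      using that A.mem_preradical[OF assms(2)] by auto
    have "Im_trans B (transported B F G \<epsilon> \<tau>) = preradical B (transport B F G \<epsilon> (T, \<tau>))"
      using B.Im_trans_mono[OF assms(1)] transport_mono_trans[OF T(1)] by (simp add: transport_def)
    also have "\<dots> = preradical B (transport B F G \<epsilon> p)"
      using B.preradical_eq_iff transport_mono_trans transport_factors T assms(2) by blast
    finally show ?thesis .
  qed
  \<comment> \<open>The class is nonempty, so the union of a constant family over it is that
    constant.\<close>
  moreover have "p \<in> preradical A p"
    using A.mem_preradical[OF assms(2)] A.factors_refl[OF assms(2)] assms(2) by blast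
  ultimately have "preradical A p \<noteq> {}"
    and "(\<Union>(T, \<tau>) \<in> preradical A p. Im_trans B (transported B F G \<epsilon> \<tau>))
      = (\<Union>_ \<in> preradical A p. preradical B (transport B F G \<epsilon> p))"
    by (blast, intro SUP_cong refl) auto
  then show ?thesis
    unfolding induced_map_def by simp
qed

text \<open>Injectivity comes from reflecting factorizations in both directions. For surjectivity,
  the transport of \<open>q\<close> to \<open>A\<close> is a preimage by the round trip on
  \<open>B\<close>.\<close>

lemma bij_betw_induced_map:
  assumes "abelian_category B"
  shows "bij_betw (induced_map B F G \<epsilon>) (Pr A) (Pr B)"
proof (rule bij_betw_imageI)
  interpret D: equivalence_pair B A G F \<delta> \<epsilon> by (rule dual)
  note map = induced_map_preradical[OF assms]
  show "inj_on (induced_map B F G \<epsilon>) (Pr A)"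
    by (auto simp: A.Pr_eq inj_on_def map B.preradical_eq_iff A.preradical_eq_iff
        transport_mono_trans transport_factors_iff)
  have "preradical B q \<in> induced_map B F G \<epsilon> ` Pr A" if q: "q \<in> mono_trans B" for q
  proof -
    note p = D.transport_mono_trans[OF q]
    have "preradical B q = induced_map B F G \<epsilon> (preradical A (transport A G F \<delta> q))"
      using map[OF p] B.preradical_eq_iff[OF q transport_mono_trans[OF p]] transport_transport[OF q]
      by simp
    then show ?thesis
      using p A.Pr_eq by blast
  qed
  then show "induced_map B F G \<epsilon> ` Pr A = Pr B"
    using map transport_mono_trans by (auto simp: A.Pr_eq B.Pr_eq)
qed

end

theorem corollary4p3:
  fixes A :: "('o, 'm) cat" and B :: "('p, 'n) cat"
    and F :: "('o, 'm, 'p, 'n) func" and G :: "('p, 'n, 'o, 'm) func"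
    and \<eta> :: "'o \<Rightarrow> 'm" and \<epsilon> :: "'p \<Rightarrow> 'n"
  assumes "abelian_category A" and "abelian_category B"
    and "is_equivalence A B F"
    and "is_adjunction A B F G \<eta> \<epsilon>"
  defines "\<phi> \<equiv> induced_map B F G \<epsilon>"
  shows "(\<forall>(T, \<tau>) \<in> mono_trans A.
            \<phi> (preradical A (T, \<tau>)) = Im_trans B (transported B F G \<epsilon> \<tau>)) \<and>
         bij_betw \<phi> (Pr A) (Pr B) \<and>
         (\<forall>P \<in> Pr A. \<forall>Q \<in> Pr A. Pr_le A P Q \<longleftrightarrow> Pr_le B (\<phi> P) (\<phi> Q))"
proof -
  obtain \<delta> where "equivalence_pair A B F G \<epsilon> \<delta>"
    using equivalence_adjunction_pair abelian_category_category assms(1-4) by metis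
  then interpret equivalence_pair A B F G \<epsilon> \<delta> .
  note map = induced_map_preradical[OF assms(2), folded \<phi>_def]
  have "\<phi> (preradical A (T, \<tau>)) = Im_trans B (transported B F G \<epsilon> \<tau>)"
    if "(T, \<tau>) \<in> mono_trans A" for T \<tau>
    using map[OF that] B.Im_trans_mono[OF assms(2)] transport_mono_trans[OF that]
    by (simp add: transport_def)
  \<comment> \<open>On representatives both orders become factorization, which transport preserves
    and reflects.\<close>
  moreover have "Pr_le A P Q \<longleftrightarrow> Pr_le B (\<phi> P) (\<phi> Q)" if "P \<in> Pr A" "Q \<in> Pr A" for P Q
    using that by (auto simp: A.Pr_eq map A.Pr_le_preradical B.Pr_le_preradical
        transport_mono_trans transport_factors_iff)
  ultimately show ?thesis
    using bij_betw_induced_map[OF assms(2)] by (auto simp: \<phi>_def)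
qed

end
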